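(* Let $A\in\mathcal{PC}_n$ and suppose that $\mathbf{e}_n$ is the Perron vector of $A$. If $A(n)$ is not well-behaved, then $\mathbf{e}_n$ is inefficient for $A$ and vertex $n$ is a sink vertex of the digraph $G(A,\mathbf{e}_n)$. Conversely, if $\mathbf{e}_{n-1}$ is efficient for $A(n)$ and the Perron vector $\mathbf{e}_n$ of $A$ is inefficient for $A$, then $A(n)$ is not well-behaved.
   Context: $n\ge 2$. $\mathcal{PC}_n$ denotes the set of $n\times n$ reciprocal matrices, i.e. real matrices $A=[a_{ij}]$ with all entries positive and $a_{ji}=1/a_{ij}$ for all $i,j$ (so $a_{ii}=1$). $\mathbf{e}_n$ is the $n$-vector with all entries $1$. The Perron vector of a positive square matrix is any entrywise positive (right) eigenvector (unique up to positive scalar multiple). $A(n)$ is the principal submatrix of $A$ obtained by deleting row and column $n$. Efficiency: a positive vector $w$ is efficient for $A\in\mathcal{PC}_n$ if, for every positive $n$-vector $v$, the inequalities $|a_{ij}-v_i/v_j|\le|a_{ij}-w_i/w_j|$ for all $i,j$ imply that $v$ is a positive scalar multiple of $w$; otherwise $w$ is inefficient. Digraph: for a positive vector $w$, $G(A,w)$ is the digraph with vertex set $\{1,\ldots,n\}$ and a directed edge $i\to j$ ($i\ne j$) if and only if $w_i/w_j\ge a_{ij}$. A sink vertex is a vertex with outdegree $0$. Well-behaved: for $B\in\mathcal{PC}_k$ with row sums listed in nonincreasing order $r_1\ge\cdots\ge r_k$, let $f(x)=\frac1x+\frac{1}{r_1-r_2+x}+\cdots+\frac{1}{r_1-r_k+x}+1-r_1-x$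 for $x>0$. $B$ is well-behaved of type I if $r_1-r_k\ge1$; it is well-behaved of type II if $r_1-r_k<1$ and $f(1+r_k-r_1)\ge0$, where $f(1+r_k-r_1)=\frac{1}{1+r_k-r_1}+\cdots+\frac{1}{1+r_k-r_{k-1}}+1-r_k$. $B$ is well-behaved if it is well-behaved of type I or of type II. *)

theory Defs
  imports
    "Jordan_Normal_Form.Char_Poly"
    "Graph_Theory.Pair_Digraph"
begin

(* Rows, columns, vector components and vertices are indexed by 0, ..., n - 1, as usual
   for the matrix library; so index n of the mathematics is n - 1 here. *)

definition reciprocal_matrices :: "nat \<Rightarrow> real mat set" where
  "reciprocal_matrices n =
     {A \<in> carrier_mat n n. \<forall>i<n. \<forall>j<n. A $$ (i, j) > 0 \<and> A $$ (j, i) = 1 / A $$ (i, j)}"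

definition positive_vecs :: "nat \<Rightarrow> real vec set" where
  "positive_vecs n = {w \<in> carrier_vec n. \<forall>i<n. w $ i > 0}"

definition ones_vec :: "nat \<Rightarrow> real vec" where
  "ones_vec n = vec n (\<lambda>_. 1)"

(* Meaningful for entrywise positive square matrices, where w is unique up to scaling. *)
definition perron_vector :: "real mat \<Rightarrow> real vec \<Rightarrow> bool" where
  "perron_vector A w \<longleftrightarrow> w \<in> positive_vecs (dim_row A) \<and> (\<exists>\<rho>. eigenvector A w \<rho>)"

definition delete_last :: "real mat \<Rightarrow> real mat" where
  "delete_last A = mat_delete A (dim_row A - 1) (dim_col A - 1)"

definition efficient :: "real mat \<Rightarrow> real vec \<Rightarrow> bool" where
  "efficient A w \<longleftrightarrow> w \<in> positive_vecs (dim_row A) \<and>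
     (\<forall>v \<in> positive_vecs (dim_row A).
        (\<forall>i<dim_row A. \<forall>j<dim_row A.
           \<bar>A $$ (i, j) - v $ i / v $ j\<bar> \<le> \<bar>A $$ (i, j) - w $ i / w $ j\<bar>)
        \<longrightarrow> (\<exists>c>0. v = c \<cdot>\<^sub>v w))"

definition inefficient :: "real mat \<Rightarrow> real vec \<Rightarrow> bool" where
  "inefficient A w \<longleftrightarrow> w \<in> positive_vecs (dim_row A) \<and> \<not> efficient A w"

definition efficiency_digraph :: "real mat \<Rightarrow> real vec \<Rightarrow> nat pair_pre_digraph" where
  "efficiency_digraph A w =
     \<lparr> pverts = {0..<dim_row A},
       parcs = {(i, j). i < dim_row A \<and> j < dim_row A \<and> i \<noteq> j \<and> w $ i / w $ j \<ge> A $$ (i, j)} \<rparr>"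

definition sink_vertex :: "('a, 'b) pre_digraph \<Rightarrow> 'a \<Rightarrow> bool" where
  "sink_vertex G v \<longleftrightarrow> v \<in> verts G \<and> out_degree G v = 0"

definition row_sums_desc :: "real mat \<Rightarrow> real list" where
  "row_sums_desc B = rev (sort (map (\<lambda>i. \<Sum>j<dim_col B. B $$ (i, j)) [0..<dim_row B]))"

(* For a k-by-k matrix, row_sums_desc B ! i is r_{i+1}; in particular
   r_1 and r_k are row_sums_desc B ! 0 and row_sums_desc B ! (k - 1). *)

definition wb_fun :: "real mat \<Rightarrow> real \<Rightarrow> real" where
  "wb_fun B x = (let r = row_sums_desc B in
     1 / x + (\<Sum>i = 1..<dim_row B. 1 / (r ! 0 - r ! i + x)) + 1 - r ! 0 - x)"

definition well_behaved_I :: "real mat \<Rightarrow> bool" where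
  "well_behaved_I B \<longleftrightarrow> (let r = row_sums_desc B; k = dim_row B in r ! 0 - r ! (k - 1) \<ge> 1)"

definition well_behaved_II :: "real mat \<Rightarrow> bool" where
  "well_behaved_II B \<longleftrightarrow> (let r = row_sums_desc B; k = dim_row B in
     r ! 0 - r ! (k - 1) < 1 \<and> wb_fun B (1 + r ! (k - 1) - r ! 0) \<ge> 0)"

definition well_behaved :: "real mat \<Rightarrow> bool" where
  "well_behaved B \<longleftrightarrow> well_behaved_I B \<or> well_behaved_II B"

end

theory Submission
  imports Defs
begin

text \<open>
  Since \<open>e\<^sub>n\<close> is the Perron vector, all row sums of \<open>A\<close> equal the Perron root \<open>\<rho>\<close>.  So the last
  column of \<open>A\<close> is determined by the row sums \<open>R\<^sub>i\<close> of \<open>B = A(n)\<close>, namely \<open>a\<^sub>i\<^sub>n = \<rho> - R\<^sub>i\<close>, and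
  by reciprocity the row sum condition for the last row reads \<open>\<Sum>\<^sub>i 1 / (\<rho> - R\<^sub>i) + 1 = \<rho>\<close>.  With
  \<open>x = \<rho> - r\<^sub>1\<close> this is \<open>f(x) = 0\<close>.  As \<open>f\<close> is strictly decreasing on the positive reals, the sign of
  \<open>f\<close> at the point \<open>1 + r\<^sub>k - r\<^sub>1\<close> tells on which side of the root that point lies: \<open>B\<close> is
  well-behaved exactly if \<open>x + r\<^sub>1 - r\<^sub>k \<ge> 1\<close>.  The left-hand side is the largest of the
  \<open>a\<^sub>i\<^sub>n\<close>, so being well-behaved means that some \<open>a\<^sub>i\<^sub>n\<close> is at least 1, which says that vertex
  \<open>n\<close> has an outgoing edge in \<open>G(A, e\<^sub>n)\<close> (\<open>well_behaved_delete_last_iff\<close>).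

  If there is no such edge, all \<open>a\<^sub>n\<^sub>i\<close> exceed 1, and a slight increase of the last component of
  \<open>e\<^sub>n\<close> brings every ratio involving it closer to its target, so \<open>e\<^sub>n\<close> is inefficient
  (\<open>inefficient_if_last_row_gt_1\<close>).

  Conversely, let \<open>n\<close> have an outgoing edge and \<open>e\<^sub>n\<^sub>-\<^sub>1\<close> be efficient for \<open>A(n)\<close>.  Vertex \<open>n\<close> also
  has an incoming edge: without one, the last row sum would be less than \<open>n\<close>, but
  \<open>a + 1/a \<ge> 2\<close> forces the average row sum of a reciprocal matrix to be at least \<open>n\<close>
  (\<open>entry_le_1_in_last_column\<close>).  A vector that is at least as good as \<open>e\<^sub>n\<close> must be constant in
  its first \<open>n - 1\<close> components by efficiency of \<open>e\<^sub>n\<^sub>-\<^sub>1\<close>; the outgoing edge bounds its last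
  component above by that constant and the incoming edge bounds it below
  (\<open>efficient_if_efficient_delete_last\<close>).
\<close>

section \<open>Sorted row sums\<close>

abbreviation row_sum :: "real mat \<Rightarrow> nat \<Rightarrow> real" where
  "row_sum B i \<equiv> \<Sum>j<dim_col B. B $$ (i, j)"

lemma length_row_sums_desc [simp]: "length (row_sums_desc B) = dim_row B"
  by (simp add: row_sums_desc_def)

lemma mset_row_sums_desc: "mset (row_sums_desc B) = mset (map (row_sum B) [0..<dim_row B])"
  by (simp add: row_sums_desc_def)

lemma set_row_sums_desc: "set (row_sums_desc B) = row_sum B ` {..<dim_row B}"
  by (simp add: row_sums_desc_def atLeast0LessThan)

lemma sum_row_sums_desc:
  "(\<Sum>i<dim_row B. g (row_sums_desc B ! i)) = (\<Sum>i<dim_row B. g (row_sum B i))"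
  for g :: "real \<Rightarrow> real"
proof -
  have "(\<Sum>i<dim_row B. g (row_sums_desc B ! i)) = sum_list (map g (row_sums_desc B))"
    by (simp add: sum_list_sum_nth atLeast0LessThan)
  also have "\<dots> = sum_list (map g (map (row_sum B) [0..<dim_row B]))"
  proof -
    have "mset (map g (row_sums_desc B)) = mset (map g (map (row_sum B) [0..<dim_row B]))"
      using mset_row_sums_desc[of B] by (simp only: mset_map)
    then show ?thesis
      by (metis sum_mset_sum_list)
  qed
  also have "\<dots> = (\<Sum>i<dim_row B. g (row_sum B i))"
    by (simp add: sum_list_sum_nth atLeast0LessThan)
  finally show ?thesis .
qed

lemma row_sums_desc_antimono:
  assumes "i \<le> j" "j < dim_row B"
  shows "row_sums_desc B ! j \<le> row_sums_desc B ! i"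
proof -
  have "sorted (rev (row_sums_desc B))"
    by (simp add: row_sums_desc_def)
  then show ?thesis
    using assms by (simp add: sorted_rev_iff_nth_mono)
qed

lemma row_sum_le_first:
  assumes "i < dim_row B"
  shows "row_sum B i \<le> row_sums_desc B ! 0"
proof -
  have "row_sum B i \<in> set (row_sums_desc B)"
    using assms by (auto simp: set_row_sums_desc)
  then obtain j where "j < dim_row B" "row_sums_desc B ! j = row_sum B i"
    by (auto simp: in_set_conv_nth)
  then show ?thesis
    using row_sums_desc_antimono[of 0 j B] by simp
qed

lemma last_le_row_sum:
  assumes "i < dim_row B"
  shows "row_sums_desc B ! (dim_row B - 1) \<le> row_sum B i"
proof -
  have "row_sum B i \<in> set (row_sums_desc B)"
    using assms by (auto simp: set_row_sums_desc)
  then obtain j where "j < dim_row B" "row_sums_desc B ! j = row_sum B i"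
    by (auto simp: in_set_conv_nth)
  then show ?thesis
    using row_sums_desc_antimono[of j "dim_row B - 1" B] by simp
qed

lemma row_sums_desc_nth_attained:
  assumes "i < dim_row B"
  shows "\<exists>j<dim_row B. row_sums_desc B ! i = row_sum B j"
  using assms nth_mem[of i "row_sums_desc B"] by (auto simp: set_row_sums_desc)

section \<open>Well-behaved matrices\<close>

text \<open>
  The term \<open>1 / x\<close> in the definition belongs to the largest row sum, and a sum over all row sums
  does not depend on their order.
\<close>

lemma wb_fun_eq_sum_over_rows:
  assumes "dim_row B > 0"
  shows "wb_fun B x = (\<Sum>i<dim_row B. 1 / (row_sums_desc B ! 0 - row_sum B i + x))
                        + 1 - row_sums_desc B ! 0 - x"
proof -
  let ?g = "\<lambda>r. 1 / (row_sums_desc B ! 0 - r + x)"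
  have "{..<dim_row B} = insert 0 {1..<dim_row B}"
    using assms by auto
  then have "(\<Sum>i<dim_row B. ?g (row_sums_desc B ! i))
      = 1 / x + (\<Sum>i = 1..<dim_row B. ?g (row_sums_desc B ! i))"
    by simp
  then show ?thesis
    by (simp add: wb_fun_def Let_def sum_row_sums_desc[of ?g, symmetric])
qed

lemma wb_fun_strict_antimono:
  assumes "dim_row B > 0" "0 < x" "x < y"
  shows "wb_fun B y < wb_fun B x"
proof -
  have "1 / (row_sums_desc B ! 0 - row_sum B i + y) \<le> 1 / (row_sums_desc B ! 0 - row_sum B i + x)"
    if "i < dim_row B" for i
    using row_sum_le_first[OF that] assms by (intro divide_left_mono) auto
  then have "(\<Sum>i<dim_row B. 1 / (row_sums_desc B ! 0 - row_sum B i + y))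
      \<le> (\<Sum>i<dim_row B. 1 / (row_sums_desc B ! 0 - row_sum B i + x))"
    by (intro sum_mono) auto
  then show ?thesis
    using assms by (simp add: wb_fun_eq_sum_over_rows)
qed

text \<open>
  Monotonicity of \<open>f\<close> lets its root be compared with \<open>1 + r\<^sub>k - r\<^sub>1\<close>.  Type I is the case in which
  that point is not positive, hence trivially to the left of the root.
\<close>

lemma well_behaved_iff_root:
  assumes "dim_row B > 0" "x > 0" "wb_fun B x = 0"
  shows "well_behaved B \<longleftrightarrow> 1 \<le> x + row_sums_desc B ! 0 - row_sums_desc B ! (dim_row B - 1)"
proof -
  define d where "d = row_sums_desc B ! 0 - row_sums_desc B ! (dim_row B - 1)"
  have point: "1 + row_sums_desc B ! (dim_row B - 1) - row_sums_desc B ! 0 = 1 - d"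
    by (simp add: d_def)
  have sign: "wb_fun B (1 - d) \<ge> 0 \<longleftrightarrow> 1 - d \<le> x" if "d < 1"
  proof (cases "1 - d" x rule: linorder_cases)
    case less
    then show ?thesis
      using wb_fun_strict_antimono[OF assms(1) _ less] that assms(3) by simp
  next
    case greater
    then show ?thesis
      using wb_fun_strict_antimono[OF assms(1,2) greater] assms(3) by simp
  qed (simp add: assms(3))
  have "well_behaved B \<longleftrightarrow> d \<ge> 1 \<or> (d < 1 \<and> wb_fun B (1 - d) \<ge> 0)"
    unfolding well_behaved_def well_behaved_I_def well_behaved_II_def Let_def point
    by (simp only: d_def)
  also have "\<dots> \<longleftrightarrow> 1 \<le> x + d"
  proof (cases "d < 1")
    case True
    then show ?thesis
      using sign by auto
  next
    case False
    then show ?thesis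
      using assms(2) by simp
  qed
  finally show ?thesis
    unfolding d_def by (simp only: add_diff_eq)
qed

section \<open>Reciprocal matrices with constant row sums\<close>

lemma reciprocal_matricesD:
  assumes "A \<in> reciprocal_matrices n"
  shows "dim_row A = n" "dim_col A = n"
    and "\<And>i j. i < n \<Longrightarrow> j < n \<Longrightarrow> A $$ (i, j) > 0"
    and "\<And>i j. i < n \<Longrightarrow> j < n \<Longrightarrow> A $$ (j, i) = 1 / A $$ (i, j)"
  using assms unfolding reciprocal_matrices_def carrier_mat_def by blast+

lemma reciprocal_diag:
  assumes "A \<in> reciprocal_matrices n" "i < n"
  shows "A $$ (i, i) = 1"
proof -
  have a: "a = 1" if "a > 0" "a = 1 / a" for a :: real
  proof -
    have "a * a = 1"
      using that by (metis less_irrefl nonzero_eq_divide_eq)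
    then show ?thesis
      using that(1) square_eq_1_iff[of a] by auto
  qed
  show ?thesis
    using reciprocal_matricesD(3,4)[OF assms(1) assms(2) assms(2)] by (rule a)
qed

lemma ones_vec_positive: "ones_vec n \<in> positive_vecs n"
  by (simp add: ones_vec_def positive_vecs_def)

lemma perron_ones_row_sums:
  assumes "A \<in> carrier_mat n n" "perron_vector A (ones_vec n)"
  obtains \<rho> where "\<And>i. i < n \<Longrightarrow> row_sum A i = \<rho>"
proof -
  obtain \<rho> where eig: "A *\<^sub>v ones_vec n = \<rho> \<cdot>\<^sub>v ones_vec n"
    using assms(2) by (auto simp: perron_vector_def eigenvector_def)
  have "row_sum A i = \<rho>" if "i < n" for i
  proof -
    have "(A *\<^sub>v ones_vec n) $ i = row_sum A i"
      using that assms(1) by (simp add: ones_vec_def scalar_prod_def atLeast0LessThan)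
    then show ?thesis
      using eig that by (simp add: ones_vec_def)
  qed
  then show ?thesis
    using that by blast
qed

lemma delete_last_index:
  assumes "A \<in> carrier_mat n n"
  shows "dim_row (delete_last A) = n - 1" "dim_col (delete_last A) = n - 1"
    and "\<And>i j. i < n - 1 \<Longrightarrow> j < n - 1 \<Longrightarrow> delete_last A $$ (i, j) = A $$ (i, j)"
  using assms by (auto simp: delete_last_def mat_delete_def)

lemma row_sum_delete_last:
  assumes "A \<in> carrier_mat n n" "i < n - 1"
  shows "row_sum A i = row_sum (delete_last A) i + A $$ (i, n - 1)"
proof -
  have "{..<n} = insert (n - 1) {..<n - 1}"
    using assms by auto
  then show ?thesis
    using assms by (simp add: delete_last_index[OF assms(1)])
qed

text \<open>
  The distance \<open>x = \<rho> - r\<^sub>1\<close> between the Perron root and the largest row sum of \<open>A(n)\<close> is the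
  positive root of \<open>f\<close>, because \<open>f(x) = 0\<close> is the row sum condition for the last row of \<open>A\<close>.
\<close>

lemma well_behaved_delete_last_iff:
  assumes "n \<ge> 2" and A: "A \<in> reciprocal_matrices n"
    and perron: "perron_vector A (ones_vec n)"
  shows "well_behaved (delete_last A) \<longleftrightarrow> (\<exists>i<n - 1. A $$ (i, n - 1) \<ge> 1)"
proof -
  let ?B = "delete_last A" and ?r = "row_sums_desc (delete_last A)"
  note [simp] = reciprocal_matricesD(1,2)[OF A]
  have carrier: "A \<in> carrier_mat n n"
    by (simp add: carrier_matI)
  note [simp] = delete_last_index[OF carrier]
  obtain \<rho> where \<rho>: "\<And>i. i < n \<Longrightarrow> row_sum A i = \<rho>"
    using perron_ones_row_sums[OF carrier perron] by blast
  have column: "A $$ (i, n - 1) = \<rho> - row_sum ?B i" if "i < n - 1" for i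
  proof -
    have "i < n"
      using that by simp
    then show ?thesis
      using row_sum_delete_last[OF carrier that] \<rho> by fastforce
  qed
  define x where "x = \<rho> - ?r ! 0"
  obtain i where i: "i < n - 1" "?r ! 0 = row_sum ?B i"
    using row_sums_desc_nth_attained[of 0 ?B] assms(1) by auto
  have "x > 0"
    using column[OF i(1)] reciprocal_matricesD(3)[OF A, of i "n - 1"] i by (simp add: x_def)
  have "(\<Sum>j<n - 1. 1 / (?r ! 0 - row_sum ?B j + x)) = (\<Sum>j<n - 1. A $$ (n - 1, j))"
  proof (rule sum.cong)
    fix j assume "j \<in> {..<n - 1}"
    then show "1 / (?r ! 0 - row_sum ?B j + x) = A $$ (n - 1, j)"
      using column[of j] reciprocal_matricesD(4)[OF A, of j "n - 1"] by (simp add: x_def)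
  qed simp
  moreover have "\<rho> = (\<Sum>j<n - 1. A $$ (n - 1, j)) + 1"
  proof -
    have "{..<n} = insert (n - 1) {..<n - 1}"
      using assms(1) by auto
    then show ?thesis
      using \<rho>[of "n - 1"] assms(1) reciprocal_diag[OF A, of "n - 1"] by simp
  qed
  ultimately have "wb_fun ?B x = 0"
    using wb_fun_eq_sum_over_rows[of ?B x] assms(1) by (simp add: x_def)
  then have "well_behaved ?B \<longleftrightarrow> 1 \<le> \<rho> - ?r ! (n - 1 - 1)"
    using well_behaved_iff_root[of ?B x] \<open>x > 0\<close> assms(1) by (simp add: x_def)
  also have "\<dots> \<longleftrightarrow> (\<exists>i<n - 1. 1 \<le> \<rho> - row_sum ?B i)"
  proof
    assume "1 \<le> \<rho> - ?r ! (n - 1 - 1)"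
    moreover have "\<exists>j<n - 1. ?r ! (n - 1 - 1) = row_sum ?B j"
      using row_sums_desc_nth_attained[of "n - 1 - 1" ?B] assms(1) by simp
    ultimately show "\<exists>i<n - 1. 1 \<le> \<rho> - row_sum ?B i"
      by metis
  next
    assume "\<exists>i<n - 1. 1 \<le> \<rho> - row_sum ?B i"
    then obtain i where "i < n - 1" "1 \<le> \<rho> - row_sum ?B i"
      by blast
    then show "1 \<le> \<rho> - ?r ! (n - 1 - 1)"
      using last_le_row_sum[of i ?B] by simp
  qed
  also have "\<dots> \<longleftrightarrow> (\<exists>i<n - 1. A $$ (i, n - 1) \<ge> 1)"
    using column by auto
  finally show ?thesis .
qed

text \<open>
  Pairing \<open>a\<^sub>i\<^sub>j\<close> with \<open>a\<^sub>j\<^sub>i = 1 / a\<^sub>i\<^sub>j\<close> and using \<open>a + 1/a \<ge> 2\<close> shows that the entries sum to at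
  least \<open>n\<^sup>2\<close>.
\<close>

lemma constant_row_sum_ge:
  assumes A: "A \<in> reciprocal_matrices n" and "n > 0"
    and \<rho>: "\<And>i. i < n \<Longrightarrow> row_sum A i = \<rho>"
  shows "\<rho> \<ge> real n"
proof -
  let ?S = "\<Sum>i<n. \<Sum>j<n. A $$ (i, j)"
  have "2 \<le> A $$ (i, j) + A $$ (j, i)" if "i < n" "j < n" for i j
  proof -
    have "0 \<le> (A $$ (i, j) - 1)\<^sup>2 / A $$ (i, j)"
      using reciprocal_matricesD(3)[OF A that] by simp
    also have "\<dots> = A $$ (i, j) + 1 / A $$ (i, j) - 2"
      using reciprocal_matricesD(3)[OF A that] by (simp add: field_simps power2_eq_square)
    finally show ?thesis
      using reciprocal_matricesD(4)[OF A that] by simp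
  qed
  then have "(\<Sum>i<n. \<Sum>j<n. 2) \<le> (\<Sum>i<n. \<Sum>j<n. A $$ (i, j) + A $$ (j, i))"
    by (intro sum_mono) auto
  also have "\<dots> = ?S + (\<Sum>i<n. \<Sum>j<n. A $$ (j, i))"
    by (simp add: sum.distrib)
  also have "(\<Sum>i<n. \<Sum>j<n. A $$ (j, i)) = ?S"
    by (rule sum.swap)
  also have "?S = real n * \<rho>"
    using \<rho> by (simp add: reciprocal_matricesD(2)[OF A])
  finally show ?thesis
    using \<open>n > 0\<close> by simp
qed

text \<open>
  Otherwise all off-diagonal entries of the last row are below 1, and its sum is below \<open>n\<close>.
\<close>

lemma entry_le_1_in_last_column:
  assumes "n \<ge> 2" and A: "A \<in> reciprocal_matrices n"
    and perron: "perron_vector A (ones_vec n)"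
  shows "\<exists>j<n - 1. A $$ (j, n - 1) \<le> 1"
proof (rule ccontr)
  assume "\<not> ?thesis"
  then have gt: "A $$ (j, n - 1) > 1" if "j < n - 1" for j
    using that by force
  note [simp] = reciprocal_matricesD(1,2)[OF A]
  obtain \<rho> where \<rho>: "\<And>i. i < n \<Longrightarrow> row_sum A i = \<rho>"
    using perron_ones_row_sums[OF _ perron] by (metis A carrier_matI reciprocal_matricesD(1,2))
  have "A $$ (n - 1, j) < 1" if "j < n - 1" for j
    using gt[OF that] reciprocal_matricesD(4)[OF A, of j "n - 1"] that by simp
  then have "(\<Sum>j<n - 1. A $$ (n - 1, j)) < (\<Sum>j<n - 1. 1)"
    using assms(1) by (intro sum_strict_mono) (auto simp: lessThan_empty_iff)
  moreover have "{..<n} = insert (n - 1) {..<n - 1}"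
    using assms(1) by auto
  then have "\<rho> = (\<Sum>j<n - 1. A $$ (n - 1, j)) + 1"
    using \<rho>[of "n - 1"] assms(1) reciprocal_diag[OF A, of "n - 1"] by simp
  ultimately have "\<rho> < real n"
    using assms(1) by simp
  then show False
    using constant_row_sum_ge[OF A _ \<rho>] assms(1) by simp
qed

section \<open>Efficiency of the vector of ones\<close>

lemma ones_vec_index [simp]: "i < n \<Longrightarrow> ones_vec n $ i = 1"
  by (simp add: ones_vec_def)

lemma inefficient_if_last_row_gt_1:
  assumes "n \<ge> 2" and A: "A \<in> reciprocal_matrices n"
    and gt: "\<And>i. i < n - 1 \<Longrightarrow> A $$ (n - 1, i) > 1"
  shows "inefficient A (ones_vec n)"
proof -
  note [simp] = reciprocal_matricesD(1,2)[OF A]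
  \<comment> \<open>The last component may grow up to the smallest target ratio without overshooting any.\<close>
  define s where "s = Min ((\<lambda>i. A $$ (n - 1, i)) ` {..<n - 1})"
  have s_le: "s \<le> A $$ (n - 1, i)" if "i < n - 1" for i
    using that by (simp add: s_def)
  have "s > 1"
    using gt assms(1) by (subst s_def, subst Min_gr_iff) (auto simp: lessThan_empty_iff)
  define v where "v = vec n (\<lambda>i. if i = n - 1 then s else 1)"
  have "v \<in> positive_vecs n"
    using \<open>s > 1\<close> by (simp add: v_def positive_vecs_def)
  moreover have "\<bar>A $$ (i, j) - v $ i / v $ j\<bar> \<le> \<bar>A $$ (i, j) - ones_vec n $ i / ones_vec n $ j\<bar>"
    if ij: "i < n" "j < n" for i j
  proof -
    consider "i = n - 1" "j = n - 1" | "i = n - 1" "j < n - 1" | "i < n - 1" "j = n - 1"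
      | "i < n - 1" "j < n - 1"
      using ij by linarith
    then show ?thesis
    proof cases
      case 2
      then show ?thesis
        using s_le[of j] \<open>s > 1\<close> ij by (simp add: v_def)
    next
      case 3
      have "1 / A $$ (n - 1, i) \<le> 1 / s"
        using s_le[of i] \<open>s > 1\<close> 3 by (intro divide_left_mono) auto
      then have "A $$ (i, n - 1) \<le> 1 / s"
        using reciprocal_matricesD(4)[OF A, of "n - 1" i] ij 3 by simp
      moreover have "1 / s < 1"
        using \<open>s > 1\<close> by simp
      ultimately show ?thesis
        using ij 3 by (simp add: v_def)
    qed (use ij \<open>s > 1\<close> in \<open>simp_all add: v_def\<close>)
  qed
  moreover have "v \<noteq> c \<cdot>\<^sub>v ones_vec n" for c
  proof
    assume eq: "v = c \<cdot>\<^sub>v ones_vec n"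
    have "v $ 0 = c" "v $ (n - 1) = c"
      using assms(1) by (subst eq, simp add: ones_vec_def)+
    then show False
      using \<open>s > 1\<close> assms(1) by (simp add: v_def)
  qed
  ultimately have "\<not> efficient A (ones_vec n)"
    by (auto simp: efficient_def)
  then show ?thesis
    by (simp add: inefficient_def ones_vec_positive)
qed

lemma sink_vertex_if_last_row_gt_1:
  assumes "n > 0" and A: "A \<in> reciprocal_matrices n"
    and gt: "\<And>i. i < n - 1 \<Longrightarrow> A $$ (n - 1, i) > 1"
  shows "sink_vertex (with_proj (efficiency_digraph A (ones_vec n))) (n - 1)"
proof -
  have "A $$ (n - 1, j) > 1" if "j < n" "j \<noteq> n - 1" for j
    using gt that by simp
  then have "out_arcs (with_proj (efficiency_digraph A (ones_vec n))) (n - 1) = {}"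
    by (fastforce simp: out_arcs_def efficiency_digraph_def reciprocal_matricesD(1)[OF A])
  then show ?thesis
    using assms(1)
    by (simp add: sink_vertex_def out_degree_def efficiency_digraph_def reciprocal_matricesD(1)[OF A])
qed

text \<open>
  Where the digraph has an edge \<open>i \<rightarrow> j\<close>, the ratio 1 approximates \<open>a\<^sub>i\<^sub>j\<close> from above, so a
  vector that is no worse has ratio at most 1 there.  A cycle through the first \<open>n - 1\<close> vertices
  (collapsed to a single value by efficiency of the smaller vector) and the last one therefore
  leaves no freedom for the last component.
\<close>

lemma efficient_if_efficient_delete_last:
  assumes "n \<ge> 2" and A: "A \<in> reciprocal_matrices n"
    and eff: "efficient (delete_last A) (ones_vec (n - 1))"
    and out_edge: "i < n - 1" "A $$ (n - 1, i) \<le> 1"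
    and in_edge: "j < n - 1" "A $$ (j, n - 1) \<le> 1"
  shows "efficient A (ones_vec n)"
  unfolding efficient_def
proof (intro conjI ballI impI)
  note [simp] = reciprocal_matricesD(1,2)[OF A]
  have carrier: "A \<in> carrier_mat n n"
    by (simp add: carrier_matI)
  note B = delete_last_index[OF carrier]
  show "ones_vec n \<in> positive_vecs (dim_row A)"
    by (simp add: ones_vec_positive)
  fix v
  assume "v \<in> positive_vecs (dim_row A)"
  then have v: "dim_vec v = n" "\<And>i. i < n \<Longrightarrow> v $ i > 0"
    by (auto simp: positive_vecs_def)
  assume "\<forall>i<dim_row A. \<forall>j<dim_row A.
    \<bar>A $$ (i, j) - v $ i / v $ j\<bar> \<le> \<bar>A $$ (i, j) - ones_vec n $ i / ones_vec n $ j\<bar>"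
  then have closer: "\<bar>A $$ (i, j) - v $ i / v $ j\<bar> \<le> \<bar>A $$ (i, j) - 1\<bar>" if "i < n" "j < n" for i j
    using that by auto
  have edge: "v $ i \<le> v $ j" if "i < n" "j < n" "A $$ (i, j) \<le> 1" for i j
  proof -
    have "v $ i / v $ j \<le> 1"
      using closer[OF that(1,2)] that(3) by linarith
    then show ?thesis
      using v(2)[OF that(2)] by (simp add: field_simps)
  qed
  let ?u = "vec (n - 1) (\<lambda>i. v $ i)"
  have "?u \<in> positive_vecs (n - 1)"
    using v by (simp add: positive_vecs_def)
  moreover have "\<forall>i<n - 1. \<forall>j<n - 1. \<bar>delete_last A $$ (i, j) - ?u $ i / ?u $ j\<bar>
      \<le> \<bar>delete_last A $$ (i, j) - ones_vec (n - 1) $ i / ones_vec (n - 1) $ j\<bar>"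
    using closer B(3) by simp
  ultimately obtain c where c: "c > 0" "?u = c \<cdot>\<^sub>v ones_vec (n - 1)"
    using eff unfolding efficient_def B(1) by blast
  have const: "v $ i = c" if "i < n - 1" for i
    using arg_cong[OF c(2), of "\<lambda>u. u $ i"] that by (simp add: ones_vec_def)
  have "v $ (n - 1) \<le> c"
    using edge[of "n - 1" i] out_edge const[of i] by simp
  moreover have "c \<le> v $ (n - 1)"
    using edge[of j "n - 1"] in_edge const[of j] by simp
  ultimately have "v $ i = c" if "i < n" for i
    using const[of i] that by (cases "i = n - 1") auto
  then have "v = c \<cdot>\<^sub>v ones_vec n"
    using v(1) by (intro eq_vecI) (auto simp: ones_vec_def)
  then show "\<exists>c>0. v = c \<cdot>\<^sub>v ones_vec n"
    using c(1) by blast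
qed

theorem theorem19:
  fixes n :: nat and A :: "real mat"
  assumes "n \<ge> 2"
    and "A \<in> reciprocal_matrices n"
    and "perron_vector A (ones_vec n)"
  shows "(\<not> well_behaved (delete_last A) \<longrightarrow>
            inefficient A (ones_vec n) \<and>
            sink_vertex (with_proj (efficiency_digraph A (ones_vec n))) (n - 1))
       \<and> (efficient (delete_last A) (ones_vec (n - 1)) \<and> inefficient A (ones_vec n) \<longrightarrow>
            \<not> well_behaved (delete_last A))"
proof -
  have transpose: "A $$ (n - 1, i) > 1 \<longleftrightarrow> A $$ (i, n - 1) < 1" if "i < n - 1" for i
    using reciprocal_matricesD(3,4)[OF assms(2), of i "n - 1"] that by simp
  have "inefficient A (ones_vec n) \<and>
      sink_vertex (with_proj (efficiency_digraph A (ones_vec n))) (n - 1)"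
    if "\<not> well_behaved (delete_last A)"
  proof -
    have "A $$ (n - 1, i) > 1" if "i < n - 1" for i
      using \<open>\<not> well_behaved (delete_last A)\<close> transpose that
      by (auto simp: well_behaved_delete_last_iff[OF assms] not_le)
    then show ?thesis
      using inefficient_if_last_row_gt_1 sink_vertex_if_last_row_gt_1 assms(1,2) by simp
  qed
  moreover have "efficient A (ones_vec n)"
    if eff: "efficient (delete_last A) (ones_vec (n - 1))" and wb: "well_behaved (delete_last A)"
  proof -
    obtain i where i: "i < n - 1" "A $$ (n - 1, i) \<le> 1"
      using wb transpose by (force simp: well_behaved_delete_last_iff[OF assms])
    obtain j where "j < n - 1" "A $$ (j, n - 1) \<le> 1"
      using entry_le_1_in_last_column[OF assms] by blast
    then show ?thesis
      using efficient_if_efficient_delete_last[OF assms(1,2) eff i] by blast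
  qed
  ultimately show ?thesis
    by (auto simp: inefficient_def)
qed

end
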